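(* Let $X,Y$ be path-connected topological spaces and let $f\colon X\to Y$ be a fibration. Consider the map $\pi\colon X^I\to X\times Y$, $\pi(\gamma)=(\gamma(0),f(\gamma(1)))$, and the projections $\pi_X\colon X\times Y\to X$ and $\pi_Y\colon X\times Y\to Y$. Then the topological complexity $\operatorname{cx}(f)$ of $f$ satisfies $$\operatorname{cx}(f)=\mathrm{D}(f\circ\pi_X,\pi_Y).$$
   Context: Here $I=[0,1]$, $X^I$ is the space of continuous paths in $X$ with the compact-open topology, and "fibration" means a map with the homotopy lifting property with respect to all spaces (Hurewicz fibration). Topological complexity of a map (normalized): $\operatorname{cx}(f)$ is the sectional complexity of $\pi$, that is, the least integer $n\geq 0$ such that $X\times Y$ can be covered by $n+1$ open subsets $U_0,\dots,U_n$ over each of which there is a continuous section $s_i\colon U_i\to X^I$ of $\pi$ (i.e. $\pi\circ s_i$ is the inclusion $U_i\hookrightarrow X\times Y$); it is $\infty$ if there is no such covering. Homotopic distance: for continuous maps $u,v\colon Z\to Y$, $\mathrm{D}(u,v)$ is the least integer $n\geq 0$ such that there is an open covering $U_0\cup\dots\cup U_n=Z$ for which the restrictions $u_{|U_j}$ and $v_{|U_j}$ are homotopic as maps $U_j\to Y$, for all $j$; if there is no such covering, $\mathrm{D}(u,v)=\infty$. *)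

theory Defs
  imports "HOL-Analysis.Analysis" "HOL-Library.Extended_Nat"
begin

abbreviation unit_interval :: "real topology" where
  "unit_interval \<equiv> top_of_set {0..1}"

text \<open>
  The space of continuous maps with the compact-open topology. Continuous maps are represented by
  functions that are \<open>undefined\<close> outside the domain, so that equality of points is equality of maps.
  The subbasic sets with empty \<open>K\<close> give the whole carrier.
\<close>

definition mapping_space :: "'a topology \<Rightarrow> 'b topology \<Rightarrow> ('a \<Rightarrow> 'b) set" where
  "mapping_space X Y = {g \<in> extensional (topspace X). continuous_map X Y g}"

definition compact_open_topology :: "'a topology \<Rightarrow> 'b topology \<Rightarrow> ('a \<Rightarrow> 'b) topology" where
  "compact_open_topology X Y =
     topology_generated_by
       {{g \<in> mapping_space X Y. g ` K \<subseteq> U} | K U. compactin X K \<and> openin Y U}"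

definition path_space :: "'a topology \<Rightarrow> (real \<Rightarrow> 'a) topology" where
  "path_space X = compact_open_topology unit_interval X"

definition homotopy_lifting_property ::
    "'c topology \<Rightarrow> 'a topology \<Rightarrow> 'b topology \<Rightarrow> ('a \<Rightarrow> 'b) \<Rightarrow> bool" where
  "homotopy_lifting_property Z X Y f \<longleftrightarrow>
     (\<forall>g H. continuous_map Z X g \<and> continuous_map (prod_topology unit_interval Z) Y H \<and>
            (\<forall>z\<in>topspace Z. H (0, z) = f (g z)) \<longrightarrow>
        (\<exists>L. continuous_map (prod_topology unit_interval Z) X L \<and>
             (\<forall>z\<in>topspace Z. L (0, z) = g z) \<and>
             (\<forall>t\<in>{0..1}. \<forall>z\<in>topspace Z. f (L (t, z)) = H (t, z))))"

text \<open>
  A Hurewicz fibration lifts homotopies from all spaces. A definition in HOL can quantify over the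
  topologies on one type only; the type below contains the mapping path space of \<open>f\<close>, which is
  enough: \<open>hurewicz_fibration_lifting\<close> below gives the homotopy lifting property for the topologies
  on every type.
\<close>

definition hurewicz_fibration :: "'a topology \<Rightarrow> 'b topology \<Rightarrow> ('a \<Rightarrow> 'b) \<Rightarrow> bool" where
  "hurewicz_fibration X Y f \<longleftrightarrow>
     continuous_map X Y f \<and>
     (\<forall>Z :: ('a \<times> (real \<Rightarrow> 'b)) topology. homotopy_lifting_property Z X Y f)"

text \<open>In the next two definitions the infimum of the empty set is \<open>\<infinity>\<close>.\<close>

definition sectional_complexity ::
    "'e topology \<Rightarrow> 'b topology \<Rightarrow> ('e \<Rightarrow> 'b) \<Rightarrow> enat" where
  "sectional_complexity E B p =
     Inf {enat n | n. \<exists>U :: nat \<Rightarrow> 'b set.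
            (\<forall>i\<le>n. openin B (U i)) \<and> (\<Union>i\<le>n. U i) = topspace B \<and>
            (\<forall>i\<le>n. \<exists>s. continuous_map (subtopology B (U i)) E s \<and> (\<forall>b\<in>U i. p (s b) = b))}"

definition homotopic_distance ::
    "'c topology \<Rightarrow> 'b topology \<Rightarrow> ('c \<Rightarrow> 'b) \<Rightarrow> ('c \<Rightarrow> 'b) \<Rightarrow> enat" where
  "homotopic_distance Z Y u v =
     Inf {enat n | n. \<exists>U :: nat \<Rightarrow> 'c set.
            (\<forall>j\<le>n. openin Z (U j)) \<and> (\<Union>j\<le>n. U j) = topspace Z \<and>
            (\<forall>j\<le>n. homotopic_with (\<lambda>_. True) (subtopology Z (U j)) Y u v)}"

definition endpoint_map :: "('a \<Rightarrow> 'b) \<Rightarrow> (real \<Rightarrow> 'a) \<Rightarrow> 'a \<times> 'b" where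
  "endpoint_map f \<gamma> = (\<gamma> 0, f (\<gamma> 1))"

definition map_complexity :: "'a topology \<Rightarrow> 'b topology \<Rightarrow> ('a \<Rightarrow> 'b) \<Rightarrow> enat" where
  "map_complexity X Y f =
     sectional_complexity (path_space X) (prod_topology X Y) (endpoint_map f)"

lemma topspace_compact_open: "topspace (compact_open_topology X Y) = mapping_space X Y"
proof -
  have "mapping_space X Y
          \<in> {{g \<in> mapping_space X Y. g ` K \<subseteq> U} | K U. compactin X K \<and> openin Y U}"
    by (rule CollectI, rule exI[of _ "{}"], rule exI[of _ "{}"]) auto
  then show ?thesis
    unfolding compact_open_topology_def topology_generated_by_topspace
    by (intro equalityI Union_least Union_upper) auto
qed

lemma openin_compact_open_subbasic:
  assumes "compactin X K" "openin Y U"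
  shows "openin (compact_open_topology X Y) {g \<in> mapping_space X Y. g ` K \<subseteq> U}"
  unfolding compact_open_topology_def
  by (rule topology_generated_by_Basis) (use assms in blast)

lemma continuous_map_path_space_eval:
  "continuous_map (prod_topology unit_interval (path_space Y)) Y (\<lambda>(t, \<gamma>). \<gamma> t)"
proof -
  let ?P = "prod_topology unit_interval (path_space Y)"
  have top: "topspace ?P = {0..1} \<times> mapping_space unit_interval Y"
    by (simp add: path_space_def topspace_compact_open)
  have "openin ?P {p \<in> topspace ?P. (\<lambda>(t, \<gamma>). \<gamma> t) p \<in> V}" if V: "openin Y V" for V
  proof (subst openin_subopen, intro ballI)
    fix p assume "p \<in> {p \<in> topspace ?P. (\<lambda>(t, \<gamma>). \<gamma> t) p \<in> V}"
    then obtain t \<gamma> where p: "p = (t, \<gamma>)" and t: "t \<in> {0..1}"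
      and g: "\<gamma> \<in> mapping_space unit_interval Y" and tV: "\<gamma> t \<in> V"
      using top by auto
    have "continuous_map unit_interval Y \<gamma>" using g by (simp add: mapping_space_def)
    then have "openin unit_interval {s \<in> {0..1}. \<gamma> s \<in> V}"
      using openin_continuous_map_preimage[OF _ V] by fastforce
    then obtain e where e: "e > 0" "ball t e \<inter> {0..1} \<subseteq> {s \<in> {0..1}. \<gamma> s \<in> V}"
      using t tV unfolding openin_contains_ball by blast
    define K where "K = cball t (e/2) \<inter> {0..1::real}"
    have K: "compactin unit_interval K" "\<gamma> ` K \<subseteq> V"
    proof -
      show "compactin unit_interval K"
        by (auto simp: K_def compactin_subtopology intro!: compact_Int)
      have "cball t (e/2) \<subseteq> ball t e" using e(1) by (auto simp: dist_real_def)
      then show "\<gamma> ` K \<subseteq> V" using e(2) unfolding K_def by blast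
    qed
    let ?W = "{g \<in> mapping_space unit_interval Y. g ` K \<subseteq> V}"
    let ?T = "({0..1} \<inter> ball t (e/2)) \<times> ?W"
    have "openin unit_interval ({0..1} \<inter> ball t (e/2))"
      by (rule openin_open_Int) simp
    then have "openin ?P ?T"
      using openin_compact_open_subbasic[OF K(1) V]
      by (simp add: openin_prod_Times_iff path_space_def)
    moreover have "p \<in> ?T" using p t g K(2) e(1) by auto
    moreover have "?T \<subseteq> {p \<in> topspace ?P. (\<lambda>(t, \<gamma>). \<gamma> t) p \<in> V}"
    proof
      fix q assume "q \<in> ?T"
      then obtain s g where q: "q = (s, g)" "s \<in> {0..1}" "s \<in> ball t (e/2)" "g \<in> ?W" by blast
      have "s \<in> K" using q(2,3) by (auto simp: K_def)
      then show "q \<in> {p \<in> topspace ?P. (\<lambda>(t, \<gamma>). \<gamma> t) p \<in> V}"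
        using q top by auto
    qed
    ultimately show "\<exists>T. openin ?P T \<and> p \<in> T
        \<and> T \<subseteq> {p \<in> topspace ?P. (\<lambda>(t, \<gamma>). \<gamma> t) p \<in> V}" by blast
  qed
  moreover have "(\<lambda>(t, \<gamma>). \<gamma> t) \<in> topspace ?P \<rightarrow> topspace Y"
    using top by (auto simp: mapping_space_def continuous_map_def)
  ultimately show ?thesis unfolding continuous_map_def by blast
qed

lemma continuous_map_path_space_curry:
  assumes H: "continuous_map (prod_topology unit_interval Z) Y H"
  shows "continuous_map Z (path_space Y) (\<lambda>z. \<lambda>t\<in>{0..1}. H (t, z))"
proof -
  let ?c = "\<lambda>z. \<lambda>t\<in>{0..1::real}. H (t, z)"
  have mem: "?c z \<in> mapping_space unit_interval Y" if z: "z \<in> topspace Z" for z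
  proof -
    have "continuous_map unit_interval (prod_topology unit_interval Z) (\<lambda>t. (t, z))"
      using z by (auto simp: continuous_map_pairwise o_def)
    then have "continuous_map unit_interval Y (H \<circ> (\<lambda>t. (t, z)))"
      using H continuous_map_compose by blast
    then have "continuous_map unit_interval Y (?c z)"
      by (rule continuous_map_eq) auto
    then show ?thesis by (simp add: mapping_space_def)
  qed
  have op: "openin Z (?c -` {g \<in> mapping_space unit_interval Y. g ` K \<subseteq> V} \<inter> topspace Z)"
    if K: "compactin unit_interval K" and V: "openin Y V" for K V
  proof -
    have KI: "K \<subseteq> {0..1}" using compactin_subset_topspace[OF K] by simp
    let ?KZ = "prod_topology (subtopology unit_interval K) Z"
    have "continuous_map ?KZ Y H"
      using continuous_map_from_subtopology[OF H, of "K \<times> UNIV"]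
      by (simp add: subtopology_Times)
    then have "openin ?KZ {p \<in> topspace ?KZ. H p \<in> V}"
      using V openin_continuous_map_preimage by blast
    then have "closedin ?KZ (topspace ?KZ - {p \<in> topspace ?KZ. H p \<in> V})"
      by (rule closedin_diff[OF closedin_topspace])
    moreover have "closed_map ?KZ Z snd"
      by (rule closed_map_snd, rule compact_space_subtopology[OF K])
    ultimately have "closedin Z (snd ` (topspace ?KZ - {p \<in> topspace ?KZ. H p \<in> V}))"
      by (simp add: closed_map_def)
    then have "openin Z (topspace Z - snd ` (topspace ?KZ - {p \<in> topspace ?KZ. H p \<in> V}))"
      by (rule openin_diff[OF openin_topspace])
    moreover have "topspace Z - snd ` (topspace ?KZ - {p \<in> topspace ?KZ. H p \<in> V})
        = ?c -` {g \<in> mapping_space unit_interval Y. g ` K \<subseteq> V} \<inter> topspace Z"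
      (is "?L = ?R")
    proof (rule set_eqI)
      fix z
      have "z \<in> ?L \<longleftrightarrow> z \<in> topspace Z \<and> (\<forall>t\<in>K. H (t, z) \<in> V)"
        using KI by (auto simp: image_iff Bex_def Ball_def split_paired_Ex split_paired_All subset_iff)
      also have "\<dots> \<longleftrightarrow> z \<in> topspace Z \<and> ?c z ` K \<subseteq> V"
        using KI by (auto simp: image_subset_iff)
      also have "\<dots> \<longleftrightarrow> z \<in> ?R"
        using mem by auto
      finally show "z \<in> ?L \<longleftrightarrow> z \<in> ?R" .
    qed
    ultimately show ?thesis by simp
  qed
  note top = topspace_compact_open[of unit_interval Y,
      unfolded compact_open_topology_def topology_generated_by_topspace]
  show ?thesis
    unfolding path_space_def compact_open_topology_def
  proof (rule continuous_on_generated_topo)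
    show "?c ` topspace Z \<subseteq>
      \<Union> {{g \<in> mapping_space unit_interval Y. g ` K \<subseteq> U} | K U.
           compactin unit_interval K \<and> openin Y U}"
      unfolding top using mem by (rule image_subsetI)
  qed (elim CollectE exE conjE, simp only: op)
qed

lemma hurewicz_fibration_lifting:
  fixes Z :: "'c topology" and X :: "'a topology" and Y :: "'b topology"
  assumes fib: "hurewicz_fibration X Y f"
  shows "homotopy_lifting_property Z X Y f"
  unfolding homotopy_lifting_property_def
proof (intro allI impI, elim conjE)
  fix g H
  assume g: "continuous_map Z X g"
    and H: "continuous_map (prod_topology unit_interval Z) Y H"
    and 0: "\<forall>z\<in>topspace Z. H (0, z) = f (g z)"
  define E where "E = subtopology (prod_topology X (path_space Y)) {(x, \<gamma>). \<gamma> 0 = f x}"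
  let ?IE = "prod_topology unit_interval E"
  have "homotopy_lifting_property E X Y f"
    using fib by (simp add: hurewicz_fibration_def)
  note lift = this[unfolded homotopy_lifting_property_def]
  have fstE: "continuous_map E X fst" and sndE: "continuous_map E (path_space Y) snd"
    unfolding E_def
    by (auto intro: continuous_map_from_subtopology continuous_map_fst continuous_map_snd)
  have "continuous_map ?IE (path_space Y) (\<lambda>p. snd (snd p))"
    using continuous_map_compose[OF continuous_map_snd sndE, of unit_interval] by (simp add: o_def)
  then have "continuous_map ?IE (prod_topology unit_interval (path_space Y))
      (\<lambda>p. (fst p, snd (snd p)))"
    by (simp add: continuous_map_paired continuous_map_fst)
  from continuous_map_compose[OF this continuous_map_path_space_eval]
  have ev: "continuous_map ?IE Y (\<lambda>(t, e). snd e t)"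
    by (simp add: o_def case_prod_unfold)
  have "\<forall>e\<in>topspace E. (\<lambda>(t, e). snd e t) (0, e) = f (fst e)"
    by (auto simp: E_def)
  with fstE ev have "\<exists>L. continuous_map ?IE X L \<and> (\<forall>e\<in>topspace E. L (0, e) = fst e) \<and>
      (\<forall>t\<in>{0..1}. \<forall>e\<in>topspace E. f (L (t, e)) = (\<lambda>(t, e). snd e t) (t, e))"
    by (intro lift[THEN spec, THEN spec, THEN mp] conjI)
  then obtain L where L: "continuous_map ?IE X L"
    "\<forall>e\<in>topspace E. L (0, e) = fst e"
    "\<forall>t\<in>{0..1}. \<forall>e\<in>topspace E. f (L (t, e)) = snd e t"
    by (elim exE conjE) simp
  define \<Phi> where "\<Phi> = (\<lambda>z. (g z, \<lambda>t\<in>{0..1}. H (t, z)))"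
  have \<Phi>: "continuous_map Z E \<Phi>"
    unfolding E_def continuous_map_in_subtopology
  proof
    show "continuous_map Z (prod_topology X (path_space Y)) \<Phi>"
      unfolding \<Phi>_def using g continuous_map_path_space_curry[OF H]
      by (simp add: continuous_map_pairwise o_def)
    show "\<Phi> \<in> topspace Z \<rightarrow> {(x, \<gamma>). \<gamma> 0 = f x}"
      using 0 by (auto simp: \<Phi>_def)
  qed
  have \<Phi>E: "\<Phi> z \<in> topspace E" if "z \<in> topspace Z" for z
    using \<Phi> that by (auto simp: continuous_map_def)
  have "continuous_map (prod_topology unit_interval Z) E (\<lambda>p. \<Phi> (snd p))"
    using continuous_map_compose[OF continuous_map_snd \<Phi>, of unit_interval] by (simp add: o_def)
  then have "continuous_map (prod_topology unit_interval Z) ?IE (\<lambda>p. (fst p, \<Phi> (snd p)))"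
    by (simp add: continuous_map_paired continuous_map_fst)
  from continuous_map_compose[OF this L(1)]
  have "continuous_map (prod_topology unit_interval Z) X (\<lambda>p. L (fst p, \<Phi> (snd p)))"
    by (simp add: o_def)
  moreover have "L (0, \<Phi> z) = g z" if "z \<in> topspace Z" for z
    using L(2) \<Phi>E[OF that] by (simp add: \<Phi>_def)
  moreover have "f (L (t, \<Phi> z)) = H (t, z)" if "t \<in> {0..1}" "z \<in> topspace Z" for t z
    using L(3) \<Phi>E[OF that(2)] that by (simp add: \<Phi>_def)
  ultimately show "\<exists>L. continuous_map (prod_topology unit_interval Z) X L \<and>
      (\<forall>z\<in>topspace Z. L (0, z) = g z) \<and>
      (\<forall>t\<in>{0..1}. \<forall>z\<in>topspace Z. f (L (t, z)) = H (t, z))"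
    by (intro exI[of _ "\<lambda>p. L (fst p, \<Phi> (snd p))"]) auto
qed

end

theory Submission
  imports Defs
begin

text \<open>
  Over an open set \<open>U\<close>, a section \<open>s\<close> of the endpoint map yields the homotopy \<open>f (s b t)\<close> from
  \<open>f \<circ> fst\<close> to \<open>snd\<close>. Conversely, a homotopy on \<open>U\<close> from \<open>f \<circ> fst\<close> to \<open>snd\<close> lifts along the
  fibration \<open>f\<close> to one starting at \<open>fst\<close>, and the adjoint of the lift is a section. So both
  invariants count the same open coverings.
\<close>

text \<open>Evaluation of paths is jointly continuous, so composing it with the identity times
  \<open>s\<close> gives the adjoint of \<open>s\<close>.\<close>

lemma continuous_map_path_space_uncurry:
  assumes "continuous_map Z (path_space Y) s"
  shows "continuous_map (prod_topology unit_interval Z) Y (\<lambda>(t, z). s z t)"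
proof -
  have "continuous_map (prod_topology unit_interval Z) (path_space Y) (\<lambda>p. s (snd p))"
    using continuous_map_compose[OF continuous_map_snd assms, of unit_interval] by (simp add: o_def)
  then have "continuous_map (prod_topology unit_interval Z)
      (prod_topology unit_interval (path_space Y)) (\<lambda>p. (fst p, s (snd p)))"
    by (simp add: continuous_map_paired continuous_map_fst)
  from continuous_map_compose[OF this continuous_map_path_space_eval] show ?thesis
    by (simp add: o_def case_prod_unfold)
qed

lemma homotopic_if_endpoint_section:
  assumes f: "continuous_map X Y f"
    and s: "continuous_map Z (path_space X) s"
    and sec: "\<And>z. z \<in> topspace Z \<Longrightarrow> endpoint_map f (s z) = z"
  shows "homotopic_with (\<lambda>_. True) Z Y (f \<circ> fst) snd"
proof -
  have "continuous_map (prod_topology unit_interval Z) Y (f \<circ> (\<lambda>(t, z). s z t))"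
    by (rule continuous_map_compose[OF continuous_map_path_space_uncurry[OF s] f])
  moreover have "s z 0 = fst z \<and> f (s z 1) = snd z" if "z \<in> topspace Z" for z
    using sec[OF that] by (simp add: endpoint_map_def prod_eq_iff)
  ultimately show ?thesis
    \<comment> \<open>The rule \<open>homotopic_with\<close> asks for the end values on
      \<open>topspace Z\<close> only, which is where \<open>s\<close> is known to be a
      section.\<close>
    by (subst homotopic_with) (auto intro!: exI[of _ "f \<circ> (\<lambda>(t, z). s z t)"])
qed

lemma endpoint_section_if_homotopic:
  assumes fib: "hurewicz_fibration X Y f"
    and fst: "continuous_map Z X fst"
    and hom: "homotopic_with (\<lambda>_. True) Z Y (f \<circ> fst) snd"
  obtains s where "continuous_map Z (path_space X) s"
    "\<And>z. z \<in> topspace Z \<Longrightarrow> endpoint_map f (s z) = z"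
proof -
  obtain H where H: "continuous_map (prod_topology unit_interval Z) Y H"
    "\<And>z. H (0, z) = f (fst z)" "\<And>z. H (1, z) = snd z"
    using hom by (auto simp: homotopic_with_def)
  \<comment> \<open>The points of \<open>Z\<close> are pairs in \<open>'a \<times> 'b\<close>, not
    of the type that \<open>hurewicz_fibration\<close> quantifies over; hence
    \<open>hurewicz_fibration_lifting\<close>.\<close>
  obtain L where L: "continuous_map (prod_topology unit_interval Z) X L"
    "\<forall>z\<in>topspace Z. L (0, z) = fst z"
    "\<forall>t\<in>{0..1}. \<forall>z\<in>topspace Z. f (L (t, z)) = H (t, z)"
    using hurewicz_fibration_lifting[OF fib, of Z] fst H(1,2)
    unfolding homotopy_lifting_property_def by blast
  show ?thesis
  proof
    \<comment> \<open>Restriction to \<open>{0..1}\<close> makes each path extensional, as a point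
      of \<open>path_space X\<close> must be, and keeps its values at 0 and 1.\<close>
    show "continuous_map Z (path_space X) (\<lambda>z. \<lambda>t\<in>{0..1}. L (t, z))"
      by (rule continuous_map_path_space_curry[OF L(1)])
    show "endpoint_map f (\<lambda>t\<in>{0..1}. L (t, z)) = z" if "z \<in> topspace Z" for z
      using L(2,3) H(3) that by (simp add: endpoint_map_def)
  qed
qed

text \<open>This matches the clauses for one member of a covering in the two invariants. By the
  inclusion, \<open>U\<close> is the whole carrier of the subspace.\<close>

lemma endpoint_section_iff_homotopic:
  assumes fib: "hurewicz_fibration X Y f" and U: "U \<subseteq> topspace (prod_topology X Y)"
  shows "(\<exists>s. continuous_map (subtopology (prod_topology X Y) U) (path_space X) s \<and>
            (\<forall>b\<in>U. endpoint_map f (s b) = b)) \<longleftrightarrow>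
         homotopic_with (\<lambda>_. True) (subtopology (prod_topology X Y) U) Y (f \<circ> fst) snd"
    (is "?S \<longleftrightarrow> ?H")
proof -
  have top: "topspace (subtopology (prod_topology X Y) U) = U"
    using U by (rule topspace_subtopology_subset)
  have f: "continuous_map X Y f"
    using fib by (simp add: hurewicz_fibration_def)
  have "continuous_map (subtopology (prod_topology X Y) U) X fst"
    by (rule continuous_map_from_subtopology[OF continuous_map_fst])
  with fib have "?S" if "?H"
    by (rule endpoint_section_if_homotopic[OF _ _ that]) (use top in blast)
  moreover have "?H" if "?S"
    using that homotopic_if_endpoint_section[OF f] top by blast
  ultimately show ?thesis by blast
qed

theorem theorem6p5:
  fixes X :: "'a topology" and Y :: "'b topology" and f :: "'a \<Rightarrow> 'b"
  assumes "path_connected_space X"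
    and "path_connected_space Y"
    and "hurewicz_fibration X Y f"
  shows "map_complexity X Y f = homotopic_distance (prod_topology X Y) Y (f \<circ> fst) snd"
  unfolding map_complexity_def sectional_complexity_def homotopic_distance_def
  \<comment> \<open>The two sets of integers agree covering by covering; \<open>conj_cong\<close>
    keeps the openness of the members, which puts each inside the product.\<close>
  by (rule arg_cong[where f = Inf], intro Collect_cong ex_cong1 conj_cong refl all_cong1 imp_cong
      endpoint_section_iff_homotopic[OF assms(3)])
    (auto dest: openin_subset)

end
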